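(* Let $X\neq\{0\}$ be a normed space and let $\theta=(k_r)$ be a lacunary sequence. If $f$ is a $\theta$-compatible modulus function, then $S_\theta^f\cap I_\theta\subset N_\theta^f$. Moreover, if $f$ is a modulus function for which $S_\theta^f\cap I_\theta\subset N_\theta^f$, then $f$ is $\theta$-compatible.
   Context: A modulus function is a function $f:\mathbb{R}^+\to\mathbb{R}^+$ (with $\mathbb{R}^+=[0,\infty)$) such that: (1) $f(x)=0$ if and only if $x=0$; (2) $f(x+y)\le f(x)+f(y)$ for all $x,y\in\mathbb{R}^+$; (3) $f$ is increasing ($x\le y$ implies $f(x)\le f(y)$); (4) $f$ is continuous from the right at $0$. All modulus functions are assumed to be unbounded. A lacunary sequence is a (strictly) increasing sequence $\theta=(k_r)_{r\ge 0}$ of natural numbers with $k_0=0$ such that $h_r:=k_r-k_{r-1}\to\infty$ as $r\to\infty$. Put $I_r=(k_{r-1},k_r]\cap\mathbb{N}$ for $r\ge1$. The modulus function $f$ is $\theta$-compatible if $\lim_{\varepsilon\to0^+}\varphi_\theta(\varepsilon)=0$, where $\varphi_\theta(\varepsilon)=\limsup_{r\to\infty}\frac{f(h_r\varepsilon)}{f(h_r)}$. For a normed space $(X,\|\cdot\|)$, with $\#$ denoting cardinality: - $N_\theta^f$ (lacunary $f$-strong Cesàro convergent sequences) is the set of sequences $(x_n)_{n\ge1}$ in $X$ for which there is $L\in X$ with $\lim_{r\to\infty}\frac{1}{f(h_r)}f\left(\sum_{k\in I_r}\|x_k-L\|\right)=0$. - $S_\theta^f$ (lacunary $f$-statistically convergent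 sequences) is the set of sequences $(x_n)_{n\ge1}$ in $X$ for which there is $L\in X$ such that for every $\varepsilon>0$, $\lim_{r\to\infty}\frac{1}{f(h_r)}f\left(\#\{k\in I_r:\|x_k-L\|>\varepsilon\}\right)=0$. - $I_\theta$ (lacunary uniformly integrable sequences) is the set of sequences $(x_n)_{n\ge1}$ in $X$ such that $$\lim_{M\to\infty}\ \sup_{r\ge1}\ \frac{1}{h_r}\sum_{k\in I_r,\ \|x_k\|\ge M}\|x_k\|=0.$$ *)

theory Defs
  imports "HOL-Analysis.Analysis"
begin

text \<open>
  A function on \<open>[0,\<infinity>)\<close> is represented by a total function \<open>real \<Rightarrow> real\<close>; its values at
  negative arguments are never constrained and never used. Modulus functions are
  unbounded by convention.
\<close>

definition modulus_function :: "(real \<Rightarrow> real) \<Rightarrow> bool" where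
  "modulus_function f \<longleftrightarrow>
     (\<forall>x\<ge>0. f x \<ge> 0) \<and>
     (\<forall>x\<ge>0. f x = 0 \<longleftrightarrow> x = 0) \<and>
     (\<forall>x\<ge>0. \<forall>y\<ge>0. f (x + y) \<le> f x + f y) \<and>
     mono_on {0..} f \<and>
     continuous (at_right 0) f \<and>
     (\<forall>B. \<exists>x\<ge>0. f x > B)"

text \<open>
  The index \<open>r = 0\<close> gives the dummy values \<open>lac_h k 0 = 0\<close> and \<open>lac_I k 0 = {}\<close>.
\<close>

definition lac_h :: "(nat \<Rightarrow> nat) \<Rightarrow> nat \<Rightarrow> nat" where
  "lac_h k r = k r - k (r - 1)"

definition lac_I :: "(nat \<Rightarrow> nat) \<Rightarrow> nat \<Rightarrow> nat set" where
  "lac_I k r = {k (r - 1)<..k r}"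

definition lacunary :: "(nat \<Rightarrow> nat) \<Rightarrow> bool" where
  "lacunary k \<longleftrightarrow> strict_mono k \<and> k 0 = 0 \<and> filterlim (lac_h k) at_top sequentially"

definition lac_phi :: "(nat \<Rightarrow> nat) \<Rightarrow> (real \<Rightarrow> real) \<Rightarrow> real \<Rightarrow> ereal" where
  "lac_phi k f \<epsilon> = limsup (\<lambda>r. ereal (f (real (lac_h k r) * \<epsilon>) / f (real (lac_h k r))))"

definition theta_compatible :: "(nat \<Rightarrow> nat) \<Rightarrow> (real \<Rightarrow> real) \<Rightarrow> bool" where
  "theta_compatible k f \<longleftrightarrow> (lac_phi k f \<longlongrightarrow> 0) (at_right 0)"

text \<open>
  A sequence \<open>(x\<^sub>n)\<close>, \<open>n \<ge> 1\<close>, is a function on \<open>nat\<close>. All blocks \<open>lac_I k r\<close> consist of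
  positive numbers, so \<open>x 0\<close> plays no role.
\<close>

definition lac_strong_Cesaro ::
    "(nat \<Rightarrow> nat) \<Rightarrow> (real \<Rightarrow> real) \<Rightarrow> (nat \<Rightarrow> 'a::real_normed_vector) set" where
  "lac_strong_Cesaro k f = {x. \<exists>L.
     (\<lambda>r. 1 / f (real (lac_h k r)) * f (\<Sum>n\<in>lac_I k r. norm (x n - L))) \<longlonglongrightarrow> 0}"

definition lac_stat_conv ::
    "(nat \<Rightarrow> nat) \<Rightarrow> (real \<Rightarrow> real) \<Rightarrow> (nat \<Rightarrow> 'a::real_normed_vector) set" where
  "lac_stat_conv k f = {x. \<exists>L. \<forall>\<epsilon>>0.
     (\<lambda>r. 1 / f (real (lac_h k r)) * f (real (card {n \<in> lac_I k r. norm (x n - L) > \<epsilon>}))) \<longlonglongrightarrow> 0}"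

text \<open>The supremum over the blocks may be infinite for some \<open>M\<close>, so it is taken in \<open>ereal\<close>.\<close>

definition lac_unif_integrable :: "(nat \<Rightarrow> nat) \<Rightarrow> (nat \<Rightarrow> 'a::real_normed_vector) set" where
  "lac_unif_integrable k = {x.
     ((\<lambda>M::real. SUP r\<in>{1..}.
         ereal (1 / real (lac_h k r) * (\<Sum>n | n \<in> lac_I k r \<and> norm (x n) \<ge> M. norm (x n))))
       \<longlongrightarrow> 0) at_top}"

end

theory Submission
  imports Defs
begin

text \<open>
  For the first part, a block sum of \<open>norm (x n - L)\<close> is cut into the terms with
  \<open>norm (x n - L) \<le> \<epsilon>\<close>, the terms with \<open>norm (x n) \<ge> M\<close>, and the remaining bounded ones. The
  first two pieces are at most a small multiple of the block length, which compatibility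
  absorbs; the third is a constant times the cardinality from statistical convergence. For the
  converse, incompatibility yields \<open>c > 0\<close> and blocks \<open>r\<^sub>0 < r\<^sub>1 < \<dots>\<close> of lengths \<open>h\<^sub>j\<close> with
  \<open>f (h\<^sub>j / (j + 1)) \<ge> c f (h\<^sub>j)\<close>. The null sequence whose norm is \<open>1 / (j + 1)\<close> on the
  block \<open>r\<^sub>j\<close> and \<open>0\<close> elsewhere is then not strongly convergent.
\<close>

section \<open>Elementary inequalities for modulus functions\<close>

lemma modulus_function_nonneg: "modulus_function f \<Longrightarrow> 0 \<le> x \<Longrightarrow> 0 \<le> f x"
  by (simp add: modulus_function_def)

lemma modulus_function_zero: "modulus_function f \<Longrightarrow> f 0 = 0"
  unfolding modulus_function_def by blast

lemma modulus_function_pos: "modulus_function f \<Longrightarrow> 0 < x \<Longrightarrow> 0 < f x"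
  unfolding modulus_function_def by (metis less_eq_real_def order_less_irrefl)

lemma modulus_function_add:
  "modulus_function f \<Longrightarrow> 0 \<le> x \<Longrightarrow> 0 \<le> y \<Longrightarrow> f (x + y) \<le> f x + f y"
  by (simp add: modulus_function_def)

lemma modulus_function_mono: "modulus_function f \<Longrightarrow> 0 \<le> x \<Longrightarrow> x \<le> y \<Longrightarrow> f x \<le> f y"
  by (auto simp: modulus_function_def mono_on_def)

text \<open>Iterated subadditivity. It stands in for homogeneity: real constants are rounded up to a
  natural number before being pulled out of \<open>f\<close>.\<close>

lemma modulus_function_mult_le:
  assumes f: "modulus_function f" and x: "0 \<le> x"
  shows "f (real n * x) \<le> real n * f x"
proof (induction n)
  case 0
  then show ?case using f by (simp add: modulus_function_zero)
next
  case (Suc n)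
  have "f (real (Suc n) * x) = f (real n * x + x)" by (simp add: algebra_simps)
  also have "\<dots> \<le> f (real n * x) + f x"
    using x by (intro modulus_function_add f) auto
  also have "\<dots> \<le> real (Suc n) * f x" using Suc by (simp add: algebra_simps)
  finally show ?case .
qed

section \<open>Lengths and indices of lacunary blocks\<close>

lemma lac_h_pos: "lacunary k \<Longrightarrow> 0 < r \<Longrightarrow> 0 < lac_h k r"
  by (simp add: lacunary_def lac_h_def strict_mono_def)

lemma card_lac_I: "card (lac_I k r) = lac_h k r"
  by (simp add: lac_I_def lac_h_def)

lemma finite_lac_I [simp]: "finite (lac_I k r)"
  by (simp add: lac_I_def)

text \<open>Recovers the block from one of its members, so that a sequence can be prescribed block
  by block through \<open>LEAST\<close>.\<close>

lemma lac_block_index: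
  assumes "lacunary k" "n \<in> lac_I k r"
  shows "(LEAST r. n \<le> k r) = r"
proof (rule Least_equality)
  show "n \<le> k r" using assms(2) by (simp add: lac_I_def)
next
  fix s assume "n \<le> k s"
  show "r \<le> s"
  proof (rule ccontr)
    assume "\<not> r \<le> s"
    then have "k s \<le> k (r - 1)"
      using assms(1) by (simp add: lacunary_def strict_mono_less_eq)
    with \<open>n \<le> k s\<close> assms(2) show False by (simp add: lac_I_def)
  qed
qed

section \<open>Compatibility as an epsilon-delta condition\<close>

text \<open>Trades the limit of limits superior for real inequalities without quotients. A single
  \<delta> suffices because \<open>f\<close> is increasing: a bound at \<delta> holds at every
  smaller positive argument.\<close>

lemma theta_compatible_iff:
  assumes k: "lacunary k" and f: "modulus_function f"
  shows "theta_compatible k f \<longleftrightarrow>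
    (\<forall>e>0. \<exists>\<delta>>0. \<forall>\<^sub>F r in sequentially. f (real (lac_h k r) * \<delta>) < e * f (real (lac_h k r)))"
    (is "_ \<longleftrightarrow> ?R")
proof
  assume c: "theta_compatible k f"
  show ?R
  proof (intro allI impI)
    fix e :: real assume "e > 0"
    then have "\<forall>\<^sub>F d in at_right 0. lac_phi k f d < ereal e"
      using c by (auto simp: theta_compatible_def intro: order_tendstoD)
    then obtain b where b: "b > 0" "\<And>d. 0 < d \<Longrightarrow> d < b \<Longrightarrow> lac_phi k f d < ereal e"
      by (auto simp: eventually_at_right_field)
    have "lac_phi k f (b/2) < ereal e" using b by simp
    then have "\<forall>\<^sub>F r in sequentially.
        ereal (f (real (lac_h k r) * (b/2)) / f (real (lac_h k r))) < ereal e"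
      unfolding lac_phi_def by (rule Limsup_lessD)
    \<comment> \<open>Clearing the denominator requires \<open>r > 0\<close>, as
      \<open>lac_h k 0 = 0\<close> and \<open>f 0 = 0\<close>.\<close>
    then have "\<forall>\<^sub>F r in sequentially. f (real (lac_h k r) * (b/2)) < e * f (real (lac_h k r))"
      using eventually_gt_at_top[of 0]
    proof eventually_elim
      case (elim r)
      have "0 < f (real (lac_h k r))"
        using lac_h_pos[OF k elim(2)] by (intro modulus_function_pos[OF f]) simp
      with elim(1) show ?case by (simp add: field_simps)
    qed
    with \<open>b > 0\<close> show "\<exists>\<delta>>0. \<forall>\<^sub>F r in sequentially.
        f (real (lac_h k r) * \<delta>) < e * f (real (lac_h k r))"
      by (intro exI[of _ "b/2"]) auto
  qed
next
  assume R: ?R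
  show "theta_compatible k f"
    unfolding theta_compatible_def
  proof (rule order_tendstoI)
    fix a :: ereal assume "a < 0"
    have "0 \<le> lac_phi k f d" if "d > 0" for d
      unfolding lac_phi_def
      using that
      by (intro le_Limsup) (auto intro!: always_eventually divide_nonneg_nonneg modulus_function_nonneg[OF f])
    then have "a < lac_phi k f d" if "d > 0" for d
      using that \<open>a < 0\<close> order_less_le_trans by blast
    then show "\<forall>\<^sub>F d in at_right 0. a < lac_phi k f d"
      by (auto simp: eventually_at_right_field intro!: exI[of _ 1])
  next
    fix a :: ereal assume "0 < a"
    \<comment> \<open>Eventual bounds by \<open>e\<close> only give a limit superior at most
      \<open>e\<close>; the gap between \<open>e\<close> and \<open>a\<close> restores
      strictness.\<close>
    then obtain e where e: "0 < ereal e" "ereal e < a"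
      using ereal_dense2 by blast
    then obtain \<delta> where d: "\<delta> > 0"
        "\<forall>\<^sub>F r in sequentially. f (real (lac_h k r) * \<delta>) < e * f (real (lac_h k r))"
      using R by auto
    have "lac_phi k f d < a" if "0 < d" "d < \<delta>" for d
    proof -
      have "\<forall>\<^sub>F r in sequentially.
          ereal (f (real (lac_h k r) * d) / f (real (lac_h k r))) \<le> ereal e"
        using d(2) eventually_gt_at_top[of 0]
      proof eventually_elim
        case (elim r)
        have "0 < f (real (lac_h k r))"
          using lac_h_pos[OF k elim(2)] by (intro modulus_function_pos[OF f]) simp
        moreover have "f (real (lac_h k r) * d) \<le> f (real (lac_h k r) * \<delta>)"
          using that by (intro modulus_function_mono[OF f] mult_left_mono) auto
        ultimately show ?case using elim(1) by (simp add: field_simps)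
      qed
      then have "lac_phi k f d \<le> ereal e"
        unfolding lac_phi_def by (rule Limsup_bounded)
      with e(2) show ?thesis by simp
    qed
    with d(1) show "\<forall>\<^sub>F d in at_right 0. lac_phi k f d < a"
      by (auto simp: eventually_at_right_field)
  qed
qed

section \<open>Compatibility implies the inclusion\<close>

text \<open>One cutoff serves all blocks at once. The free bound \<open>B\<close> allows
  \<open>M\<close> to be taken above the norm of the limit.\<close>

lemma lac_unif_integrableD:
  assumes k: "lacunary k" and x: "x \<in> lac_unif_integrable k" and e: "e > 0"
  shows "\<exists>M\<ge>B. \<forall>r>0. (\<Sum>n | n \<in> lac_I k r \<and> norm (x n) \<ge> M. norm (x n)) \<le> e * real (lac_h k r)"
proof -
  let ?S = "\<lambda>M r. \<Sum>n | n \<in> lac_I k r \<and> norm (x n) \<ge> M. norm (x n)"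
  have "\<forall>\<^sub>F M in at_top. (SUP r\<in>{1..}. ereal (1 / real (lac_h k r) * ?S M r)) < ereal e"
    using x e unfolding lac_unif_integrable_def by (auto intro: order_tendstoD)
  with eventually_ge_at_top[of B]
  have "\<forall>\<^sub>F M in at_top. B \<le> M \<and>
      (SUP r\<in>{1..}. ereal (1 / real (lac_h k r) * ?S M r)) < ereal e"
    by (rule eventually_conj)
  then obtain M where M: "B \<le> M"
      "(SUP r\<in>{1..}. ereal (1 / real (lac_h k r) * ?S M r)) < ereal e"
    using eventually_happens trivial_limit_at_top_linorder by blast
  have "?S M r \<le> e * real (lac_h k r)" if "r > 0" for r
  proof -
    have "ereal (1 / real (lac_h k r) * ?S M r) \<le>
        (SUP r\<in>{1..}. ereal (1 / real (lac_h k r) * ?S M r))"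
      using that by (intro SUP_upper) auto
    then have "ereal (1 / real (lac_h k r) * ?S M r) < ereal e"
      using M(2) by (rule order_le_less_trans)
    then show ?thesis
      using lac_h_pos[OF k that] by (simp add: field_simps)
  qed
  with M(1) show ?thesis by blast
qed

text \<open>Holds term by term: a deviation above \<open>e\<close> is at most
  \<open>M + norm L\<close> when \<open>norm (x n) < M\<close>, and at most
  \<open>2 * norm (x n)\<close> when \<open>norm (x n) \<ge> M\<close>, since then
  \<open>norm L \<le> norm (x n)\<close>.\<close>

lemma sum_norm_diff_le:
  fixes x :: "'b \<Rightarrow> 'a::real_normed_vector"
  assumes A: "finite A" and M: "norm L \<le> M" and e: "0 \<le> e"
  shows "(\<Sum>n\<in>A. norm (x n - L)) \<le> e * real (card A)
    + (M + norm L) * real (card {n\<in>A. norm (x n - L) > e})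
    + 2 * (\<Sum>n | n \<in> A \<and> norm (x n) \<ge> M. norm (x n))"
proof -
  have "(\<Sum>n\<in>A. norm (x n - L)) \<le> (\<Sum>n\<in>A. e + (if norm (x n - L) > e then M + norm L else 0)
      + 2 * (if norm (x n) \<ge> M then norm (x n) else 0))"
  proof (rule sum_mono)
    fix n
    have "norm (x n - L) \<le> norm (x n) + norm L" by (rule norm_triangle_ineq4)
    moreover have "0 \<le> norm L" by simp
    ultimately show "norm (x n - L) \<le> e + (if norm (x n - L) > e then M + norm L else 0)
        + 2 * (if norm (x n) \<ge> M then norm (x n) else 0)"
      using M e by (smt (verit))
  qed
  also have "\<dots> = e * real (card A) + (M + norm L) * real (card {n\<in>A. norm (x n - L) > e})
      + 2 * (\<Sum>n | n \<in> A \<and> norm (x n) \<ge> M. norm (x n))"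
    using A by (simp add: sum.distrib sum.inter_filter[symmetric] flip: sum_distrib_left)
  finally show ?thesis .
qed

lemma lac_strong_CesaroI:
  assumes k: "lacunary k" and f: "modulus_function f" and c: "theta_compatible k f"
    and S: "x \<in> lac_stat_conv k f" and I: "x \<in> lac_unif_integrable k"
  shows "x \<in> lac_strong_Cesaro k f"
proof -
  obtain L where L: "\<And>e. e > 0 \<Longrightarrow>
     (\<lambda>r. 1 / f (real (lac_h k r)) * f (real (card {n \<in> lac_I k r. norm (x n - L) > e}))) \<longlonglongrightarrow> 0"
    using S unfolding lac_stat_conv_def by auto
  have "(\<lambda>r. 1 / f (real (lac_h k r)) * f (\<Sum>n\<in>lac_I k r. norm (x n - L))) \<longlonglongrightarrow> 0"
  proof (rule order_tendstoI)
    fix a :: real assume "a < 0"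
    have "0 \<le> 1 / f (real (lac_h k r)) * f (\<Sum>n\<in>lac_I k r. norm (x n - L))" for r
      by (intro mult_nonneg_nonneg divide_nonneg_nonneg modulus_function_nonneg[OF f] sum_nonneg) auto
    with \<open>a < 0\<close> show "\<forall>\<^sub>F r in sequentially.
        a < 1 / f (real (lac_h k r)) * f (\<Sum>n\<in>lac_I k r. norm (x n - L))"
      by (intro always_eventually allI) (rule order_less_le_trans)
  next
    fix a :: real assume a: "0 < a"
    obtain \<delta> where d: "\<delta> > 0"
        "\<forall>\<^sub>F r in sequentially. f (real (lac_h k r) * \<delta>) < (a/2) * f (real (lac_h k r))"
      using c a unfolding theta_compatible_iff[OF k f] by (meson half_gt_zero)
    \<comment> \<open>Small deviations cost \<open>e\<close> times the block length and the doubled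
      tail costs twice that, together exactly \<delta> times the length.\<close>
    define e where "e = \<delta> / 3"
    have e: "e > 0" using d by (simp add: e_def)
    obtain M where M: "norm L \<le> M"
      "\<And>r. r > 0 \<Longrightarrow> (\<Sum>n | n \<in> lac_I k r \<and> norm (x n) \<ge> M. norm (x n)) \<le> e * real (lac_h k r)"
      using lac_unif_integrableD[OF k I e] by blast
    obtain N :: nat where N: "M + norm L \<le> real N" using real_arch_simple by blast
    let ?C = "\<lambda>r. real (card {n \<in> lac_I k r. norm (x n - L) > e})"
    \<comment> \<open>\<open>N\<close> may be 0, so \<open>N + 1\<close> is used in the denominator;
      the other half of \<open>a\<close> goes to the compatibility term.\<close>
    have "\<forall>\<^sub>F r in sequentially. 1 / f (real (lac_h k r)) * f (?C r) < a / (2 * (real N + 1))"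
      using a by (intro order_tendstoD(2)[OF L[OF e]]) auto
    with d(2) eventually_gt_at_top[of 0]
    show "\<forall>\<^sub>F r in sequentially.
        1 / f (real (lac_h k r)) * f (\<Sum>n\<in>lac_I k r. norm (x n - L)) < a"
    proof eventually_elim
      case (elim r)
      let ?h = "real (lac_h k r)"
      have fh: "0 < f ?h"
        using lac_h_pos[OF k elim(2)] by (intro modulus_function_pos[OF f]) simp
      have "(\<Sum>n\<in>lac_I k r. norm (x n - L)) \<le> e * ?h + (M + norm L) * ?C r
          + 2 * (\<Sum>n | n \<in> lac_I k r \<and> norm (x n) \<ge> M. norm (x n))"
        using sum_norm_diff_le[of "lac_I k r" L M e x] M(1) e by (simp add: card_lac_I)
      also have "\<dots> \<le> e * ?h + real N * ?C r + 2 * (e * ?h)"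
        using N M(2)[OF elim(2)] by (intro add_mono mult_right_mono mult_left_mono) auto
      also have "\<dots> = ?h * \<delta> + real N * ?C r" by (simp add: e_def)
      finally have "f (\<Sum>n\<in>lac_I k r. norm (x n - L)) \<le> f (?h * \<delta> + real N * ?C r)"
        by (intro modulus_function_mono[OF f] sum_nonneg) auto
      also have "\<dots> \<le> f (?h * \<delta>) + f (real N * ?C r)"
        using d by (intro modulus_function_add[OF f]) auto
      also have "\<dots> \<le> f (?h * \<delta>) + real N * f (?C r)"
        by (intro add_left_mono modulus_function_mult_le[OF f]) auto
      also have "\<dots> \<le> f (?h * \<delta>) + (real N + 1) * f (?C r)"
        using modulus_function_nonneg[OF f, of "?C r"] by (simp add: algebra_simps)
      also have "\<dots> < (a/2) * f ?h + (a/2) * f ?h"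
      proof (rule add_strict_mono)
        show "f (?h * \<delta>) < a / 2 * f ?h" by (rule elim(1))
        show "(real N + 1) * f (?C r) < (a/2) * f ?h"
          using elim(3) fh by (simp add: field_simps)
      qed
      finally show ?case using fh by (simp add: field_simps)
    qed
  qed
  then show ?thesis unfolding lac_strong_Cesaro_def by blast
qed

section \<open>The inclusion implies compatibility\<close>

text \<open>A diagonal choice: strictly increasing indices \<open>s j\<close> are picked with
  \<open>P\<close> true at \<open>1 / (j + 1)\<close>, and these values become a single null
  sequence. The bound by 1 later gives uniform integrability.\<close>

lemma frequently_imp_null_witnesses:
  assumes "\<And>\<delta>::real. \<delta> > 0 \<Longrightarrow> \<exists>\<^sub>F r in sequentially. P r \<delta>"
  shows "\<exists>a. (\<forall>r. 0 \<le> a r \<and> a r \<le> 1) \<and> a \<longlonglongrightarrow> 0 \<and> (\<exists>\<^sub>F r in sequentially. P r (a r))"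
proof -
  have "\<exists>s. \<forall>j. P (s j) (1 / real (Suc j)) \<and> s j < s (Suc j)"
  proof (rule dependent_nat_choice)
    show "\<exists>r. P r (1 / real (Suc 0))"
      using assms[of 1] frequently_ex by fastforce
  next
    fix r j
    show "\<exists>s. P s (1 / real (Suc (Suc j))) \<and> r < s"
      using assms[of "1 / real (Suc (Suc j))"] unfolding frequently_sequentially
      by (metis Suc_le_eq of_nat_0_less_iff zero_less_Suc zero_less_divide_1_iff)
  qed
  then obtain s where P: "\<And>j. P (s j) (1 / real (Suc j))" and "\<And>j. s j < s (Suc j)"
    by blast
  then have s: "strict_mono s" by (simp add: strict_mono_Suc_iff)
  \<comment> \<open>\<open>inv s\<close> is meaningful on the range because \<open>s\<close> is
    injective; the value 0 elsewhere keeps \<open>a\<close> null.\<close>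
  define a where "a r = (if r \<in> range s then 1 / real (Suc (inv s r)) else 0)" for r
  have a_s: "a (s j) = 1 / real (Suc j)" for j
    using strict_mono_imp_inj_on[OF s] by (simp add: a_def)
  have a0: "0 \<le> a r" for r by (simp add: a_def)
  show ?thesis
  proof (intro exI conjI allI)
    show "0 \<le> a r" "a r \<le> 1" for r by (auto simp: a_def)
    show "a \<longlonglongrightarrow> 0"
    proof (rule LIMSEQ_I)
      fix e :: real assume "0 < e"
      then obtain J where J: "1 / real (Suc J) < e"
        using nat_approx_posE by blast
      have "a r < e" if "r \<ge> s J" for r
      proof (cases "r \<in> range s")
        case True
        then obtain j where r: "r = s j" by blast
        then have "J \<le> j" using that s by (simp add: strict_mono_less_eq)
        then have "1 / real (Suc j) \<le> 1 / real (Suc J)" by (simp add: frac_le)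
        then show ?thesis using J by (simp add: r a_s)
      qed (use \<open>0 < e\<close> in \<open>simp add: a_def\<close>)
      then show "\<exists>N. \<forall>r\<ge>N. norm (a r - 0) < e" using a0 by auto
    qed
    show "\<exists>\<^sub>F r in sequentially. P r (a r)"
      unfolding frequently_sequentially
    proof
      fix N
      have "s N \<ge> N" by (rule strict_mono_imp_increasing[OF s])
      then show "\<exists>r\<ge>N. P r (a r)" using P[of N] a_s by auto
    qed
  qed
qed

text \<open>Strong convergence permits any limit, so a counterexample has to exclude the nonzero
  ones. For \<open>L \<noteq> 0\<close> the terms of late blocks stay at distance at least
  \<open>norm L / 2\<close> from \<open>L\<close>, and subadditivity then keeps the quotient above a
  positive constant.\<close>

lemma null_block_sequence_limit_zero:
  fixes x :: "nat \<Rightarrow> 'a::real_normed_vector"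
  assumes k: "lacunary k" and f: "modulus_function f" and a: "a \<longlonglongrightarrow> 0"
    and x: "\<And>r n. n \<in> lac_I k r \<Longrightarrow> norm (x n) = a r"
    and lim: "(\<lambda>r. 1 / f (real (lac_h k r)) * f (\<Sum>n\<in>lac_I k r. norm (x n - L))) \<longlonglongrightarrow> 0"
  shows "L = 0"
proof (rule ccontr)
  assume "L \<noteq> 0"
  define l where "l = norm L / 2"
  have l: "l > 0" using \<open>L \<noteq> 0\<close> by (simp add: l_def)
  \<comment> \<open>With \<open>N * l \<ge> 1\<close>, a block length \<open>h\<close> satisfies
    \<open>h \<le> N * (h * l)\<close>, whence \<open>f h \<le> N * f (h * l)\<close>.\<close>
  obtain N :: nat where N: "1 / l \<le> real N" using real_arch_simple by blast
  have N0: "0 < real N" using N l by (smt (verit) divide_pos_pos)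
  have "\<forall>\<^sub>F r in sequentially. a r < l"
    using a l by (rule order_tendstoD)
  moreover have "\<forall>\<^sub>F r in sequentially.
      1 / f (real (lac_h k r)) * f (\<Sum>n\<in>lac_I k r. norm (x n - L)) < 1 / real N"
    using N0 by (intro order_tendstoD(2)[OF lim]) simp
  ultimately have "\<forall>\<^sub>F r::nat in sequentially. False"
    using eventually_gt_at_top[of 0]
  proof eventually_elim
    case (elim r)
    let ?h = "real (lac_h k r)"
    have fh: "0 < f ?h"
      using lac_h_pos[OF k elim(3)] by (intro modulus_function_pos[OF f]) simp
    have "f ?h \<le> f (real N * (?h * l))"
    proof (rule modulus_function_mono[OF f])
      have "1 \<le> real N * l" using N l by (simp add: field_simps)
      then have "?h * 1 \<le> ?h * (real N * l)" by (intro mult_left_mono) auto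
      then show "?h \<le> real N * (?h * l)" by (simp add: algebra_simps)
    qed simp
    also have "\<dots> \<le> real N * f (?h * l)"
      using l by (intro modulus_function_mult_le[OF f]) auto
    also have "\<dots> \<le> real N * f (\<Sum>n\<in>lac_I k r. norm (x n - L))"
    proof (intro mult_left_mono modulus_function_mono[OF f])
      have "l \<le> norm (x n - L)" if "n \<in> lac_I k r" for n
        using norm_triangle_ineq3[of "x n" L] x[OF that] elim(1) by (simp add: l_def)
      then have "(\<Sum>n\<in>lac_I k r. l) \<le> (\<Sum>n\<in>lac_I k r. norm (x n - L))"
        by (rule sum_mono)
      then show "?h * l \<le> (\<Sum>n\<in>lac_I k r. norm (x n - L))" by (simp add: card_lac_I)
    qed (use l in auto)
    finally show False using elim(2) fh N0 by (simp add: field_simps)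
  qed
  then show False by simp
qed

lemma theta_compatibleI:
  assumes nontriv: "(UNIV :: 'a::real_normed_vector set) \<noteq> {0}"
    and k: "lacunary k" and f: "modulus_function f"
    and sub: "(lac_stat_conv k f \<inter> lac_unif_integrable k :: (nat \<Rightarrow> 'a) set) \<subseteq> lac_strong_Cesaro k f"
  shows "theta_compatible k f"
proof (rule ccontr)
  assume "\<not> theta_compatible k f"
  then obtain c where c: "c > 0" and
      nc: "\<not> (\<exists>\<delta>>0. \<forall>\<^sub>F r in sequentially.
        f (real (lac_h k r) * \<delta>) < c * f (real (lac_h k r)))"
    unfolding theta_compatible_iff[OF k f] by blast
  have freq: "\<exists>\<^sub>F r in sequentially. c * f (real (lac_h k r)) \<le> f (real (lac_h k r) * \<delta>)"
    if "\<delta> > 0" for \<delta>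
    using nc that unfolding frequently_def not_le by blast
  obtain a where a: "\<And>r. 0 \<le> a r" "\<And>r. a r \<le> 1" "a \<longlonglongrightarrow> 0"
      and freq_a: "\<exists>\<^sub>F r in sequentially. c * f (real (lac_h k r)) \<le> f (real (lac_h k r) * a r)"
    using frequently_imp_null_witnesses
      [where P = "\<lambda>r \<delta>. c * f (real (lac_h k r)) \<le> f (real (lac_h k r) * \<delta>)", OF freq]
    by auto
  obtain w :: 'a where "w \<noteq> 0" using nontriv by auto
  \<comment> \<open>A unit vector makes the norms of the sequence equal to the prescribed values
    \<open>a r\<close>.\<close>
  define v where "v = sgn w"
  have v: "norm v = 1" using \<open>w \<noteq> 0\<close> by (simp add: v_def norm_sgn)
  define x where "x n = a (LEAST r. n \<le> k r) *\<^sub>R v" for n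
  have nx: "norm (x n) = a r" if "n \<in> lac_I k r" for r n
    using a(1) by (simp add: x_def lac_block_index[OF k that] v)
  have nx1: "norm (x n) \<le> 1" for n
    using a(1,2) by (simp add: x_def v)
  have "x \<in> lac_stat_conv k f"
    unfolding lac_stat_conv_def
  proof (intro CollectI exI[of _ 0] allI impI)
    fix e :: real assume "e > 0"
    with a(3) have "\<forall>\<^sub>F r in sequentially. a r < e" by (rule order_tendstoD)
    then have "\<forall>\<^sub>F r in sequentially.
        1 / f (real (lac_h k r)) * f (real (card {n \<in> lac_I k r. norm (x n - 0) > e})) = 0"
    proof eventually_elim
      case (elim r)
      \<comment> \<open>All norms in the block equal \<open>a r < e\<close>, so the quotient is
        exactly 0 from some block on.\<close>
      have "{n \<in> lac_I k r. norm (x n - 0) > e} = {}"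
        using elim nx by fastforce
      then show ?case by (simp only: card.empty of_nat_0 modulus_function_zero[OF f] mult_zero_right)
    qed
    then show "(\<lambda>r. 1 / f (real (lac_h k r)) *
        f (real (card {n \<in> lac_I k r. norm (x n - 0) > e}))) \<longlonglongrightarrow> 0"
      by (rule tendsto_eventually)
  qed
  moreover have "x \<in> lac_unif_integrable k"
    unfolding lac_unif_integrable_def
  proof (intro CollectI tendsto_eventually)
    show "\<forall>\<^sub>F M in at_top. (SUP r\<in>{1..}. ereal (1 / real (lac_h k r) *
        (\<Sum>n | n \<in> lac_I k r \<and> norm (x n) \<ge> M. norm (x n)))) = 0"
      using eventually_gt_at_top[of "1::real"]
    proof eventually_elim
      case (elim M)
      \<comment> \<open>Every norm is at most 1, so no term reaches a cutoff
        \<open>M > 1\<close>.\<close>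
      have "{n. n \<in> lac_I k r \<and> norm (x n) \<ge> M} = {}" for r
        using order_le_less_trans[OF nx1 elim] by (simp add: not_le)
      then have "(\<Sum>n | n \<in> lac_I k r \<and> norm (x n) \<ge> M. norm (x n)) = 0" for r
        by (simp only: sum.empty)
      then show ?case by (simp flip: zero_ereal_def)
    qed
  qed
  ultimately obtain L where
      L: "(\<lambda>r. 1 / f (real (lac_h k r)) * f (\<Sum>n\<in>lac_I k r. norm (x n - L))) \<longlonglongrightarrow> 0"
    using sub unfolding lac_strong_Cesaro_def by blast
  have "L = 0"
    by (rule null_block_sequence_limit_zero[OF k f a(3) _ L]) (rule nx)
  \<comment> \<open>With limit 0 the block sum is exactly the argument of \<open>f\<close> in
    \<open>freq_a\<close>, so the quotient is at least \<open>c\<close> infinitely often.\<close>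
  have "(\<Sum>n\<in>lac_I k r. norm (x n - L)) = real (lac_h k r) * a r" for r
    by (simp add: \<open>L = 0\<close> nx card_lac_I)
  then have "\<forall>\<^sub>F r in sequentially. 1 / f (real (lac_h k r)) * f (real (lac_h k r) * a r) < c"
    using order_tendstoD(2)[OF L c] by simp
  then have "\<forall>\<^sub>F r in sequentially. f (real (lac_h k r) * a r) < c * f (real (lac_h k r))"
    using eventually_gt_at_top[of 0]
  proof eventually_elim
    case (elim r)
    have "0 < f (real (lac_h k r))"
      using lac_h_pos[OF k elim(2)] by (intro modulus_function_pos[OF f]) simp
    with elim(1) show ?case by (simp add: field_simps)
  qed
  with freq_a show False by (simp add: frequently_def not_le)
qed

theorem theorem4p3:
  fixes k :: "nat \<Rightarrow> nat" and f :: "real \<Rightarrow> real"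
  assumes "(UNIV :: 'a::real_normed_vector set) \<noteq> {0}"
    and "lacunary k"
    and "modulus_function f"
  shows "(theta_compatible k f \<longrightarrow>
            (lac_stat_conv k f \<inter> lac_unif_integrable k :: (nat \<Rightarrow> 'a) set) \<subseteq> lac_strong_Cesaro k f) \<and>
         ((lac_stat_conv k f \<inter> lac_unif_integrable k :: (nat \<Rightarrow> 'a) set) \<subseteq> lac_strong_Cesaro k f \<longrightarrow>
            theta_compatible k f)"
proof (intro conjI impI subsetI)
  fix x :: "nat \<Rightarrow> 'a"
  assume "theta_compatible k f" "x \<in> lac_stat_conv k f \<inter> lac_unif_integrable k"
  then show "x \<in> lac_strong_Cesaro k f"
    by (intro lac_strong_CesaroI[OF assms(2,3)]) simp_all
qed (rule theta_compatibleI[OF assms])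

end
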